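(* For every finite, simple, undirected, connected graph $G$ with at least two vertices, $\chi_{ON}(G) \leq \max\{3, \mathsf{dc}(G)+1\}$.
   Context: A CFON coloring of a graph $G=(V,E)$ with $k$ colors is a map $C: V \to \{1,\dots,k\}$ such that for every $v \in V$ there is a color $i$ with $|N(v)\cap C^{-1}(i)| = 1$, where $N(v)$ is the open neighborhood of $v$. $\chi_{ON}(G)$ is the minimum $k$ for which a CFON coloring with $k$ colors exists. The distance to cluster $\mathsf{dc}(G)$ is the size of a smallest set $X \subseteq V$ such that $G[V\setminus X]$ is a disjoint union of cliques. *)

theory Defs
  imports
    "Graph_Theory.Digraph_Component"
    "HOL-Library.Disjoint_Sets"
    "HOL-Library.Extended_Nat"
begin

text \<open>Undirected simple graphs are the locale \<^locale>\<open>graph\<close>: finite, loop-free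
  symmetric digraphs without parallel arcs, so each edge is a pair of opposite arcs.\<close>

definition open_neighborhood :: "('a,'b) pre_digraph \<Rightarrow> 'a \<Rightarrow> 'a set" where
  "open_neighborhood G v = {u \<in> verts G. v \<rightarrow>\<^bsub>G\<^esub> u}"

definition cfon_coloring :: "('a,'b) pre_digraph \<Rightarrow> nat \<Rightarrow> ('a \<Rightarrow> nat) \<Rightarrow> bool" where
  "cfon_coloring G k C \<longleftrightarrow>
     C ` verts G \<subseteq> {1..k} \<and>
     (\<forall>v \<in> verts G. \<exists>i \<in> {1..k}. card {u \<in> open_neighborhood G v. C u = i} = 1)"

text \<open>A graph with an isolated vertex has no CFON coloring at all; it gets the value \<open>\<infinity>\<close>.\<close>

definition cfon_chromatic_number :: "('a,'b) pre_digraph \<Rightarrow> enat" where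
  "cfon_chromatic_number G = Inf {enat k | k. \<exists>C. cfon_coloring G k C}"

definition disjoint_union_of_cliques :: "('a,'b) pre_digraph \<Rightarrow> bool" where
  "disjoint_union_of_cliques H \<longleftrightarrow>
     (\<exists>P. partition_on (verts H) P \<and>
          (\<forall>u \<in> verts H. \<forall>v \<in> verts H.
             u \<rightarrow>\<^bsub>H\<^esub> v \<longleftrightarrow> u \<noteq> v \<and> (\<exists>K \<in> P. u \<in> K \<and> v \<in> K)))"

definition distance_to_cluster :: "('a,'b) pre_digraph \<Rightarrow> nat" where
  "distance_to_cluster G =
     (LEAST d. \<exists>X. X \<subseteq> verts G \<and> finite X \<and> card X = d \<and>
                   disjoint_union_of_cliques (G \<restriction> (verts G - X)))"

end

theory Submission
  imports Defs
begin

text \<open>Induction on the size of a cluster deletion set \<open>X\<close>, for colourings in which only the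
  non-isolated vertices need a uniquely coloured neighbour. While \<open>card X \<ge> 3\<close>, pick \<open>y \<in> X\<close> and a
  neighbour \<open>w\<close> of \<open>y\<close>, delete both, and give both the same new colour: every vertex adjacent to
  exactly one of them, and \<open>y\<close> and \<open>w\<close> themselves, see that colour once, and the others keep
  their witness unless their neighbourhood is exactly \<open>{y, w}\<close>. If every neighbour \<open>w\<close> of \<open>y\<close>
  is obstructed in this way, then the component of \<open>y\<close> is a set of triangles sharing \<open>y\<close>
  and is coloured separately. For \<open>X = {x, y}\<close> three colours suffice by a case analysis in
  which each clique is coloured on its own.\<close>

section \<open>Uniquely coloured neighbours and clusters, relative to a vertex set\<close>

text \<open>\<open>V\<close> is a parameter so that induced subgraphs arise by shrinking
  \<open>V\<close> while \<open>E\<close> stays fixed.\<close>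

definition happy :: "('a \<Rightarrow> 'a \<Rightarrow> bool) \<Rightarrow> 'a set \<Rightarrow> ('a \<Rightarrow> nat) \<Rightarrow> 'a \<Rightarrow> bool" where
  "happy E V C v \<longleftrightarrow>
     (\<exists>u\<in>V. E v u \<and> (\<forall>u'\<in>V. E v u' \<and> C u' = C u \<longrightarrow> u' = u))"

text \<open>Absence of an induced path on three vertices, which for symmetric \<open>E\<close>
  characterises disjoint unions of cliques and passes to subsets at once.\<close>

definition cluster :: "('a \<Rightarrow> 'a \<Rightarrow> bool) \<Rightarrow> 'a set \<Rightarrow> bool" where
  "cluster E S \<longleftrightarrow>
     (\<forall>u\<in>S. \<forall>v\<in>S. \<forall>w\<in>S. E u v \<and> E v w \<and> u \<noteq> w \<longrightarrow> E u w)"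

lemma happyI:
  "u \<in> V \<Longrightarrow> E v u \<Longrightarrow> (\<And>u'. u' \<in> V \<Longrightarrow> E v u' \<Longrightarrow> C u' = C u \<Longrightarrow> u' = u) \<Longrightarrow> happy E V C v"
  unfolding happy_def by blast

lemma happy_cong:
  "(\<And>u. u \<in> V \<Longrightarrow> E v u \<Longrightarrow> C u = C' u) \<Longrightarrow> happy E V C v = happy E V C' v"
  unfolding happy_def by (metis (no_types, lifting))

lemma cluster_subset: "cluster E S \<Longrightarrow> T \<subseteq> S \<Longrightarrow> cluster E T"
  unfolding cluster_def by blast

locale sym_irrefl =
  fixes E :: "'a \<Rightarrow> 'a \<Rightarrow> bool"
  assumes sym: "E u v \<Longrightarrow> E v u"
    and irrefl [simp]: "\<not> E v v"
begin

lemma adj_commute: "E u v \<longleftrightarrow> E v u"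
  using sym by blast

end

section \<open>Two deleted vertices: the remaining cliques and gluing of their colourings\<close>

locale two_vertex_cluster = sym_irrefl +
  fixes V :: "'a set" and x y :: 'a
  assumes xy: "x \<in> V" "y \<in> V" "x \<noteq> y"
    and clus: "cluster E (V - {x, y})"
    and no_isolated: "v \<in> V \<Longrightarrow> \<exists>u\<in>V. E v u"
begin

definition colorable :: bool where
  "colorable \<longleftrightarrow> (\<exists>C. (\<forall>v\<in>V. happy E V C v) \<and> C ` V \<subseteq> {..2})"

definition clique_of :: "'a \<Rightarrow> 'a set" where
  "clique_of v = {u \<in> V - {x, y}. u = v \<or> E v u}"

definition cliques :: "'a set set" where
  "cliques = clique_of ` (V - {x, y})"

lemma clique_of: "v \<in> V - {x, y} \<Longrightarrow> v \<in> clique_of v" "v \<in> V - {x, y} \<Longrightarrow> clique_of v \<in> cliques"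
  by (auto simp: clique_of_def cliques_def)

lemma cliqueD:
  assumes "K \<in> cliques"
  shows "K \<subseteq> V" "x \<notin> K" "y \<notin> K" "K \<noteq> {}"
  using assms by (auto simp: clique_of_def cliques_def)

text \<open>The vertex \<open>k\<close> with \<open>K = clique_of k\<close> serves as a hub: the
  cluster property carries adjacency from \<open>v\<close> through \<open>k\<close> to
  \<open>u\<close> and back.\<close>

lemma clique_adj:
  assumes "K \<in> cliques" "v \<in> K" "u \<in> V - {x, y}"
  shows "E v u \<longleftrightarrow> u \<in> K \<and> u \<noteq> v"
proof -
  from assms(1) obtain k where k: "k \<in> V - {x, y}" "K = clique_of k"
    by (auto simp: cliques_def)
  have *: "\<And>a b c. a \<in> V - {x, y} \<Longrightarrow> b \<in> V - {x, y} \<Longrightarrow> c \<in> V - {x, y} \<Longrightarrow>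
      E a b \<Longrightarrow> E b c \<Longrightarrow> a \<noteq> c \<Longrightarrow> E a c"
    using clus unfolding cluster_def by blast
  have v: "v \<in> V - {x, y}" "v = k \<or> E k v"
    using assms(2) k by (auto simp: clique_of_def)
  show ?thesis
  proof
    assume vu: "E v u"
    then have "u = k \<or> E k u"
      using v *[OF k(1) v(1) assms(3)] by blast
    then show "u \<in> K \<and> u \<noteq> v" using assms(3) k vu irrefl by (auto simp: clique_of_def)
  next
    assume "u \<in> K \<and> u \<noteq> v"
    then show "E v u"
      using v k * [OF v(1) k(1) assms(3)] adj_commute[of v k] by (auto simp: clique_of_def)
  qed
qed

lemma clique_eq:
  assumes "K \<in> cliques" "v \<in> K"
  shows "clique_of v = K"
  using clique_adj[OF assms] cliqueD[OF assms(1)] assms(2)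
  by (auto simp: clique_of_def)

text \<open>A vertex of \<open>K\<close> sees only the rest of \<open>K\<close> and possibly the
  roots \<open>x\<close>, \<open>y\<close>, so a witness \<open>u\<close> has to be compared with
  these alone.\<close>

lemma clique_happyI:
  assumes "K \<in> cliques" "v \<in> K" "u \<in> K \<and> u \<noteq> v \<or> u \<in> {x, y} \<and> E v u"
    and "\<And>u'. u' \<in> K \<Longrightarrow> u' \<noteq> v \<Longrightarrow> C u' = C u \<Longrightarrow> u' = u"
    and "E v x \<Longrightarrow> C x = C u \<Longrightarrow> x = u" "E v y \<Longrightarrow> C y = C u \<Longrightarrow> y = u"
  shows "happy E V C v"
proof (rule happyI[of u])
  show "u \<in> V" using assms cliqueD xy by blast
  then show "E v u" using assms clique_adj[OF assms(1,2)] cliqueD[OF assms(1)] by blast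
  fix u' assume "u' \<in> V" "E v u'" "C u' = C u"
  then show "u' = u" using assms clique_adj[OF assms(1,2), of u'] by blast
qed

lemma root_happyI:
  assumes "r = x \<and> s = y \<or> r = y \<and> s = x" "w \<in> V" "E r w"
    and "\<And>v. v \<in> V - {x, y} \<Longrightarrow> E r v \<Longrightarrow> C v = C w \<Longrightarrow> v = w"
    and "E r s \<Longrightarrow> C s = C w \<Longrightarrow> s = w"
  shows "happy E V C r"
proof (rule happyI[of w])
  fix u assume u: "u \<in> V" "E r u" "C u = C w"
  then have "u \<noteq> r" using irrefl by blast
  then show "u = w" using assms(1,4,5) u by blast
qed (use assms in auto)

text \<open>Vertices outside \<open>{x, y}\<close> see only their own clique and the roots, so once
  \<open>cx\<close> and \<open>cy\<close> are fixed the cliques are coloured independently.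
  \<open>P\<close> is the contract under which the local choices leave witnesses for
  \<open>x\<close> and \<open>y\<close>.\<close>

lemma glue:
  assumes loc: "\<And>K. K \<in> cliques \<Longrightarrow>
      \<exists>f. f x = cx \<and> f y = cy \<and> (\<forall>v\<in>K. P v (f v) \<and> f v \<le> (2::nat) \<and> happy E V f v)"
    and glob: "\<And>C. C x = cx \<Longrightarrow> C y = cy \<Longrightarrow> (\<And>v. v \<in> V - {x, y} \<Longrightarrow> P v (C v)) \<Longrightarrow>
      happy E V C x \<and> happy E V C y"
    and le: "cx \<le> 2" "cy \<le> 2"
  shows colorable
proof -
  from loc obtain F where F: "\<And>K. K \<in> cliques \<Longrightarrow> F K x = cx \<and> F K y = cy \<and>
      (\<forall>v\<in>K. P v (F K v) \<and> F K v \<le> 2 \<and> happy E V (F K) v)" by metis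
  define C where "C v = (if v = x then cx else if v = y then cy else F (clique_of v) v)" for v
  have C: "P v (C v) \<and> C v \<le> 2 \<and> happy E V C v" if v: "v \<in> V - {x, y}" for v
  proof -
    note K = clique_of[OF v]
    have "happy E V C v = happy E V (F (clique_of v)) v"
    proof (rule happy_cong)
      fix u assume u: "u \<in> V" "E v u"
      show "C u = F (clique_of v) u"
      proof (cases "u \<in> {x, y}")
        case True then show ?thesis using F[OF K(2)] by (auto simp: C_def)
      next
        case False
        then have "u \<in> clique_of v" using clique_adj[OF K(2,1)] u by blast
        then show ?thesis using False clique_eq[OF K(2)] by (auto simp: C_def)
      qed
    qed
    then show ?thesis using F[OF K(2)] K(1) v by (auto simp: C_def)
  qed
  have "happy E V C x \<and> happy E V C y"
    by (rule glob) (use C xy in \<open>auto simp: C_def\<close>)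
  then show ?thesis unfolding colorable_def using C le xy
    by (intro exI[of _ C]) (auto simp: C_def)
qed

section \<open>Three colours suffice: case analysis on the neighbours of \<open>x\<close> and
  \<open>y\<close>\<close>

lemma two_in_clique:
  assumes "K \<in> cliques" "z \<in> K" "\<not> E z x" "\<not> E z y"
  obtains u where "u \<in> K" "u \<noteq> z"
proof -
  obtain u where "u \<in> V" "E z u" using assms cliqueD no_isolated by blast
  then show ?thesis using that clique_adj[OF assms(1,2)] assms by blast
qed

text \<open>Meant for cliques without the distinguished vertex: colour \<open>1\<close> is reserved
  for that vertex among the clique vertices seen by a root.\<close>

lemma clique_avoiding_1:
  assumes K: "K \<in> cliques"
  shows "\<exists>f. f x = 1 \<and> f y = (2::nat) \<and>
     (\<forall>v\<in>K. (E v x \<or> E v y \<longrightarrow> f v \<noteq> 1) \<and> f v \<le> 2 \<and> happy E V f v)"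
proof (cases "\<exists>z\<in>K. \<not> E z x \<and> \<not> E z y")
  case True
  then obtain z where z: "z \<in> K" "\<not> E z x" "\<not> E z y" by blast
  then obtain u where u: "u \<in> K" "u \<noteq> z" using two_in_clique K by blast
  \<comment> \<open>\<open>u\<close> alone has colour \<open>0\<close> and is the witness of all
    others in \<open>K\<close>. The witness of \<open>u\<close> is \<open>x\<close> if adjacent, and
    otherwise \<open>z\<close>, which may take \<open>1\<close> because no root sees it.\<close>
  define f where "f v = (if v = x then 1 else if v = y then 2 else if v = u then 0
      else if v = z then (if E u x then 2 else 1) else (2::nat))" for v
  have "happy E V f v" if v: "v \<in> K" for v
  proof (cases "v = u")
    case True
    show ?thesis
      by (rule clique_happyI[OF K v, of "if E u x then x else z"])
        (use True z u cliqueD[OF K] xy in \<open>auto simp: f_def split: if_splits\<close>)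
  next
    case False
    show ?thesis
      by (rule clique_happyI[OF K v, of u])
        (use False z u cliqueD[OF K] xy in \<open>auto simp: f_def split: if_splits\<close>)
  qed
  then show ?thesis using z u cliqueD[OF K] xy
    by (intro exI[of _ f]) (auto simp: f_def)
next
  case False
  \<comment> \<open>Every vertex of \<open>K\<close> sees a root, and the colours of the two roots
    are distinct and absent from \<open>K\<close>.\<close>
  define f where "f v = (if v = x then 1 else if v = y then 2 else (0::nat))" for v
  have "happy E V f v" if v: "v \<in> K" for v
    by (rule clique_happyI[OF K v, of "if E v x then x else y"])
      (use False v cliqueD[OF K] xy in \<open>auto simp: f_def split: if_splits\<close>)
  then show ?thesis using cliqueD[OF K] xy
    by (intro exI[of _ f]) (auto simp: f_def)
qed

text \<open>The vertex \<open>w\<close> gets colour \<open>1\<close>, which no other neighbour of \<open>x\<close> or \<open>y\<close> outside \<open>{x, y}\<close>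
  has, and \<open>x\<close>, \<open>y\<close> get \<open>1\<close>, \<open>2\<close>. Then \<open>x\<close> sees \<open>1\<close> only at \<open>w\<close>, and \<open>y\<close> sees \<open>1\<close> only at
  \<open>w\<close> or only at \<open>x\<close>.\<close>

lemma colorable_distinguished:
  assumes w: "w \<in> V - {x, y}" "E w x" "E x y \<noteq> E w y"
    and b: "(\<exists>b\<in>clique_of w. \<not> E b x) \<or> (E w y \<and> (\<forall>v\<in>clique_of w. E v x \<longrightarrow> E v y))"
  shows colorable
proof (rule glue[where cx = 1 and cy = 2 and
      P = "\<lambda>v c. if v = w then c = 1 else E v x \<or> E v y \<longrightarrow> c \<noteq> 1"])
  fix C :: "'a \<Rightarrow> nat"
  assume C: "C x = 1" "C y = 2"
    and P: "\<And>v. v \<in> V - {x, y} \<Longrightarrow> if v = w then C v = 1 else E v x \<or> E v y \<longrightarrow> C v \<noteq> 1"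
  have Cw: "C w = 1" using P[OF w(1)] by simp
  have other: "v = w" if v: "v \<in> V - {x, y}" "E x v \<or> E y v" "C v = C w" for v
  proof (rule ccontr)
    assume "v \<noteq> w"
    then have "C v \<noteq> 1" using P[OF v(1)] v(2) sym by metis
    then show False using v(3) Cw by simp
  qed
  show "happy E V C x \<and> happy E V C y"
  proof
    show "happy E V C x"
    proof (rule root_happyI[of x y w])
      show "E x w" using w(2) by (rule sym)
      show "v = w" if "v \<in> V - {x, y}" "E x v" "C v = C w" for v
        by (rule other) (use that in auto)
    qed (use w(1) C Cw in auto)
    show "happy E V C y"
    proof (cases "E w y")
      case True
      then have "E y w" "\<not> E y x" using w(3) adj_commute[of y w] adj_commute[of y x] by auto
      show ?thesis
      proof (rule root_happyI[of y x w])
        show "v = w" if "v \<in> V - {x, y}" "E y v" "C v = C w" for v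
          by (rule other) (use that in auto)
      qed (use w(1) \<open>E y w\<close> \<open>\<not> E y x\<close> in auto)
    next
      case False
      then have "E y x" using w(3) adj_commute[of y x] by auto
      show ?thesis
      proof (rule root_happyI[of y x x])
        fix v assume v: "v \<in> V - {x, y}" "E y v" "C v = C x"
        have "v = w" by (rule other) (use v C Cw in auto)
        then show "v = x" using v(2) False adj_commute[of y w] by simp
      qed (use xy \<open>E y x\<close> in auto)
    qed
  qed
next
  fix K assume K: "K \<in> cliques"
  show "\<exists>f. f x = 1 \<and> f y = 2 \<and> (\<forall>v\<in>K. (if v = w then f v = 1 else E v x \<or> E v y \<longrightarrow> f v \<noteq> 1)
      \<and> f v \<le> (2::nat) \<and> happy E V f v)"
  proof (cases "w \<in> K")
    case False
    from clique_avoiding_1[OF K] obtain f where "f x = 1" "f y = 2"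
      "\<forall>v\<in>K. (E v x \<or> E v y \<longrightarrow> f v \<noteq> 1) \<and> f v \<le> 2 \<and> happy E V f v" by blast
    with False show ?thesis by (intro exI[of _ f]) auto
  next
    case wK: True
    then have Kw: "clique_of w = K" using clique_eq K by blast
    show ?thesis
    proof (cases "\<exists>b\<in>K. \<not> E b x")
      case True
      then obtain b where b: "b \<in> K" "\<not> E b x" by blast
      then have bw: "b \<noteq> w" using w by blast
      \<comment> \<open>\<open>b\<close> is the witness of all others by colour \<open>0\<close>;
        its own witness is \<open>w\<close>, since \<open>b\<close> does not see \<open>x\<close>,
        which also has colour \<open>1\<close>.\<close>
      define f where "f v = (if v = x then 1 else if v = y then 2 else if v = w then 1
          else if v = b then 0 else (2::nat))" for v
      have "happy E V f v" if v: "v \<in> K" for v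
        by (rule clique_happyI[OF K v, of "if v = b then w else b"])
          (use b bw wK cliqueD[OF K] xy in \<open>auto simp: f_def split: if_splits\<close>)
      then show ?thesis using bw cliqueD[OF K] xy wK
        by (intro exI[of _ f]) (auto simp: f_def)
    next
      case False
      with b Kw have b': "E w y" "\<forall>v\<in>K. E v x \<longrightarrow> E v y" by auto
      \<comment> \<open>Now all of \<open>K\<close> sees both roots, and \<open>y\<close> is the
        only neighbour of colour \<open>2\<close>.\<close>
      define f where "f v = (if v = x then 1 else if v = y then 2 else if v = w then 1
          else (0::nat))" for v
      have "happy E V f v" if v: "v \<in> K" for v
        by (rule clique_happyI[OF K v, of y])
          (use b' v False wK cliqueD[OF K] xy in \<open>auto simp: f_def split: if_splits\<close>)
      then show ?thesis using cliqueD[OF K] xy wK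
        by (intro exI[of _ f]) (auto simp: f_def)
    qed
  qed
qed auto

lemma colorable_distinguished_swap:
  assumes w: "w \<in> V - {x, y}" "E w y" "E x y \<noteq> E w x" and b: "\<exists>b\<in>clique_of w. \<not> E b y"
  shows colorable
proof -
  \<comment> \<open>The locale assumptions are symmetric in the roots, and \<open>colorable\<close>
    does not mention them.\<close>
  interpret yx: two_vertex_cluster E V y x
    using xy clus no_isolated by unfold_locales (auto simp: insert_commute)
  have "yx.clique_of w = clique_of w"
    by (auto simp: yx.clique_of_def clique_of_def)
  moreover have "E y x = E x y" using sym by blast
  ultimately show ?thesis
    using yx.colorable_distinguished[of w] w b by (simp add: insert_commute)
qed

text \<open>\<open>w\<close> is a distinguished vertex for either order of the roots. If its clique
  has no vertex missing a root, the inclusion alternative holds trivially.\<close>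

lemma colorable_nonadjacent_common:
  assumes "\<not> E x y" "w \<in> V - {x, y}" "E w x" "E w y"
  shows colorable
proof -
  consider "\<exists>b\<in>clique_of w. \<not> E b x" | "\<exists>b\<in>clique_of w. \<not> E b y"
    | "\<forall>b\<in>clique_of w. E b x \<and> E b y" by blast
  then show ?thesis
    using colorable_distinguished[of w] colorable_distinguished_swap[of w] assms by cases blast+
qed

text \<open>Both roots take \<open>w\<close> as witness, with colour \<open>0\<close> reserved for
  it. By \<open>uni\<close>, a clique covered by the roots is covered by one of them, which can then
  be the witness of the whole clique.\<close>

lemma colorable_adjacent_common:
  assumes adj: "E x y" and w: "w \<in> V - {x, y}" "E w x" "E w y"
    and uni: "\<And>K. K \<in> cliques \<Longrightarrow> \<forall>v\<in>K. E v x \<or> E v y \<Longrightarrow> (\<forall>v\<in>K. E v x) \<or> (\<forall>v\<in>K. E v y)"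
  shows colorable
proof (rule glue[where cx = 1 and cy = 2 and
      P = "\<lambda>v c. if v = w then c = 0 else E v x \<or> E v y \<longrightarrow> c \<noteq> 0"])
  fix C :: "'a \<Rightarrow> nat"
  assume C: "C x = 1" "C y = 2"
    and P: "\<And>v. v \<in> V - {x, y} \<Longrightarrow> if v = w then C v = 0 else E v x \<or> E v y \<longrightarrow> C v \<noteq> 0"
  have Cw: "C w = 0" using P[OF w(1)] by simp
  have other: "v = w" if v: "v \<in> V - {x, y}" "E x v \<or> E y v" "C v = C w" for v
  proof (rule ccontr)
    assume "v \<noteq> w"
    then have "C v \<noteq> 0" using P[OF v(1)] v(2) sym by metis
    then show False using v(3) Cw by simp
  qed
  have xw: "E x w" "E y w" using w(2,3) by (auto intro: sym)
  show "happy E V C x \<and> happy E V C y"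
  proof
    show "happy E V C x"
    proof (rule root_happyI[of x y w])
      show "v = w" if "v \<in> V - {x, y}" "E x v" "C v = C w" for v
        by (rule other) (use that in auto)
    qed (use w(1) xw C Cw in auto)
    show "happy E V C y"
    proof (rule root_happyI[of y x w])
      show "v = w" if "v \<in> V - {x, y}" "E y v" "C v = C w" for v
        by (rule other) (use that in auto)
    qed (use w(1) xw C Cw in auto)
  qed
next
  fix K assume K: "K \<in> cliques"
  show "\<exists>f. f x = 1 \<and> f y = 2 \<and> (\<forall>v\<in>K. (if v = w then f v = 0 else E v x \<or> E v y \<longrightarrow> f v \<noteq> 0)
      \<and> f v \<le> (2::nat) \<and> happy E V f v)"
  proof (cases "w \<in> K")
    case True
    \<comment> \<open>The witness of \<open>w\<close> is \<open>y\<close>, alone in having colour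
      \<open>2\<close>; the witness of the others is \<open>w\<close>.\<close>
    define f where "f v = (if v = x then 1 else if v = y then 2 else if v = w then 0
        else (1::nat))" for v
    have "happy E V f v" if v: "v \<in> K" for v
      by (rule clique_happyI[OF K v, of "if v = w then y else w"])
        (use w True cliqueD[OF K] xy in \<open>auto simp: f_def split: if_splits\<close>)
    then show ?thesis using cliqueD[OF K] xy True
      by (intro exI[of _ f]) (auto simp: f_def)
  next
    case wK: False
    show ?thesis
    proof (cases "\<exists>z\<in>K. \<not> E z x \<and> \<not> E z y")
      case True
      then obtain z where z: "z \<in> K" "\<not> E z x" "\<not> E z y" by blast
      then obtain u where u: "u \<in> K" "u \<noteq> z" using two_in_clique K by blast
      \<comment> \<open>No root sees \<open>z\<close>, so \<open>z\<close> may take the reserved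
        colour and be the witness of the others; its own witness is \<open>u\<close>.\<close>
      define f where "f v = (if v = x then 1 else if v = y then 2 else if v = z then 0
          else if v = u then 1 else (2::nat))" for v
      have "happy E V f v" if v: "v \<in> K" for v
        by (rule clique_happyI[OF K v, of "if v = z then u else z"])
          (use z u cliqueD[OF K] xy in \<open>auto simp: f_def split: if_splits\<close>)
      then show ?thesis using z u cliqueD[OF K] xy wK
        by (intro exI[of _ f]) (auto simp: f_def)
    next
      case False
      then consider "\<forall>v\<in>K. E v x" | "\<forall>v\<in>K. E v y" using uni[OF K] by blast
      then show ?thesis
      proof cases
        case all: 1
        \<comment> \<open>The clique repeats the colour of \<open>y\<close>, which leaves
          \<open>x\<close> as the only neighbour of colour \<open>1\<close>.\<close>
        define f where "f v = (if v = x then 1 else if v = y then 2 else (2::nat))" for v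
        have "happy E V f v" if v: "v \<in> K" for v
        proof (rule clique_happyI[OF K v, of x])
          show "x \<in> K \<and> x \<noteq> v \<or> x \<in> {x, y} \<and> E v x" using all v by blast
        qed (use cliqueD[OF K] xy in \<open>auto simp: f_def split: if_splits\<close>)
        then show ?thesis using cliqueD[OF K] xy wK
          by (intro exI[of _ f]) (auto simp: f_def)
      next
        case all: 2
        define f where "f v = (if v = x then 1 else if v = y then 2 else (1::nat))" for v
        have "happy E V f v" if v: "v \<in> K" for v
        proof (rule clique_happyI[OF K v, of y])
          show "y \<in> K \<and> y \<noteq> v \<or> y \<in> {x, y} \<and> E v y" using all v by blast
        qed (use cliqueD[OF K] xy in \<open>auto simp: f_def split: if_splits\<close>)
        then show ?thesis using cliqueD[OF K] xy wK
          by (intro exI[of _ f]) (auto simp: f_def)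
      qed
    qed
  qed
qed auto

text \<open>The roots are witnesses of each other by colour \<open>0\<close>. A clique covered by
  them avoids \<open>0\<close>, and each of its vertices sees exactly one root. By
  \<open>uni\<close>, any other clique is out of sight of both roots and may use \<open>0\<close>
  freely.\<close>

lemma colorable_adjacent_disjoint:
  assumes adj: "E x y" and disj: "\<And>v. v \<in> V \<Longrightarrow> \<not> (E v x \<and> E v y)"
    and uni: "\<And>K z v. K \<in> cliques \<Longrightarrow> z \<in> K \<Longrightarrow> \<not> E z x \<Longrightarrow> \<not> E z y \<Longrightarrow> v \<in> K \<Longrightarrow> \<not> E v x \<and> \<not> E v y"
  shows colorable
proof (rule glue[where cx = 0 and cy = 0 and P = "\<lambda>v c. E v x \<or> E v y \<longrightarrow> c \<noteq> 0"])
  fix C :: "'a \<Rightarrow> nat"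
  assume C: "C x = 0" "C y = 0" 
    and P: "\<And>v. v \<in> V - {x, y} \<Longrightarrow> E v x \<or> E v y \<longrightarrow> C v \<noteq> 0"
  have nz: "C v \<noteq> 0" if "v \<in> V - {x, y}" "E x v \<or> E y v" for v
    using P[OF that(1)] that(2) sym by blast
  show "happy E V C x \<and> happy E V C y"
    using root_happyI[of x y y C] root_happyI[of y x x C] xy adj sym[OF adj] nz C by simp
next
  fix K assume K: "K \<in> cliques"
  show "\<exists>f. f x = 0 \<and> f y = 0 \<and> (\<forall>v\<in>K. (E v x \<or> E v y \<longrightarrow> f v \<noteq> 0)
      \<and> f v \<le> (2::nat) \<and> happy E V f v)"
  proof (cases "\<exists>z\<in>K. \<not> E z x \<and> \<not> E z y")
    case True
    then obtain z where z: "z \<in> K" "\<not> E z x" "\<not> E z y" by blast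
    then obtain u where u: "u \<in> K" "u \<noteq> z" using two_in_clique K by blast
    have un: "\<And>v. v \<in> K \<Longrightarrow> \<not> E v x \<and> \<not> E v y" using uni[OF K z] .
    define f where "f v = (if v = z then 2 else if v = u then 1 else (0::nat))" for v
    have "happy E V f v" if v: "v \<in> K" for v
      by (rule clique_happyI[OF K v, of "if v = z then u else z"])
        (use z u un v cliqueD[OF K] xy in \<open>auto simp: f_def split: if_splits\<close>)
    then show ?thesis using z u cliqueD[OF K] xy un
      by (intro exI[of _ f]) (auto simp: f_def)
  next
    case False
    define f where "f v = (if v = x \<or> v = y then 0 else (1::nat))" for v
    have "happy E V f v" if v: "v \<in> K" for v
      by (rule clique_happyI[OF K v, of "if E v x then x else y"])
        (use v False disj cliqueD[OF K] xy in \<open>auto simp: f_def split: if_splits\<close>)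
    then show ?thesis using cliqueD[OF K] xy
      by (intro exI[of _ f]) (auto simp: f_def)
  qed
qed auto

text \<open>A vertex seeing exactly one root is distinguished if its clique has a vertex missing
  that root. If this never happens, the cliques are uniform enough for the hypotheses
  \<open>uni\<close> of the other two cases.\<close>

lemma colorable_adjacent:
  assumes adj: "E x y"
  shows colorable
proof -
  show ?thesis
  proof (cases "\<exists>K\<in>cliques. \<exists>a\<in>K. \<exists>b\<in>K. E a x \<and> \<not> E a y \<and> \<not> E b x \<or> E a y \<and> \<not> E a x \<and> \<not> E b y")
    case True
    then obtain K a b where K: "K \<in> cliques" "a \<in> K" "b \<in> K"
      and ab: "E a x \<and> \<not> E a y \<and> \<not> E b x \<or> E a y \<and> \<not> E a x \<and> \<not> E b y" by blast
    have a: "a \<in> V - {x, y}" using K cliqueD by blast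
    have "b \<in> clique_of a" using K clique_eq by blast
    with ab consider "E a x" "\<not> E a y" "\<not> E b x" | "E a y" "\<not> E a x" "\<not> E b y" by blast
    then show ?thesis
      using colorable_distinguished[of a] colorable_distinguished_swap[of a] a adj
        \<open>b \<in> clique_of a\<close> by cases blast+
  next
    case False
    show ?thesis
    proof (cases "\<exists>w\<in>V. E w x \<and> E w y")
      case True
      then obtain w where "w \<in> V - {x, y}" "E w x" "E w y" using irrefl by blast
      then show ?thesis
        by (rule colorable_adjacent_common[OF adj]) (use False in blast)
    next
      case disj: False
      show ?thesis
        by (rule colorable_adjacent_disjoint[OF adj]) (use disj False cliqueD in blast)+
    qed
  qed
qed

text \<open>Each root gets its own witness: \<open>a\<close> with colour \<open>1\<close> for
  \<open>x\<close>, \<open>b\<close> with colour \<open>2\<close> for \<open>y\<close>. The roots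
  share colour \<open>0\<close>, which is safe because no vertex sees both.\<close>

lemma colorable_nonadjacent_disjoint:
  assumes nadj: "\<not> E x y" and disj: "\<And>v. v \<in> V \<Longrightarrow> \<not> (E v x \<and> E v y)"
  shows colorable
proof -
  \<comment> \<open>Taking \<open>a\<close> and \<open>b\<close> adjacent whenever possible ensures
    that a clique containing just one of them does not have neighbours of both roots.\<close>
  obtain a b where ab: "a \<in> V" "E a x" "b \<in> V" "E b y"
    and pref: "(\<exists>a'\<in>V. \<exists>b'\<in>V. E a' x \<and> E b' y \<and> E a' b') \<longrightarrow> E a b"
    using no_isolated[OF xy(1)] no_isolated[OF xy(2)] sym by metis
  have out: "a \<in> V - {x, y}" "b \<in> V - {x, y}" and "a \<noteq> b"
    using ab disj nadj sym irrefl by blast+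
  have same: "a \<in> K \<and> b \<in> K" if K: "K \<in> cliques" "a' \<in> K" "b' \<in> K" "E a' x" "E b' y" "a \<in> K \<or> b \<in> K" for K a' b'
  proof -
    have "a' \<in> V" "b' \<in> V - {x, y}" "a' \<noteq> b'" using K cliqueD[OF K(1)] disj by auto
    then have "E a b" using clique_adj[OF K(1,2), of b'] pref K by blast
    then show ?thesis using K(6) clique_adj[OF K(1)] out sym by blast
  qed
  have xor: "\<not> E v x \<or> \<not> E v y" if "v \<in> K" "K \<in> cliques" for v K
    using that cliqueD disj by blast
  show ?thesis
  proof (rule glue[where cx = 0 and cy = 0 and P = "\<lambda>v c. if v = a then c = 1 else if v = b then c = 2
          else (E v x \<longrightarrow> c \<noteq> 1) \<and> (E v y \<longrightarrow> c \<noteq> 2)"])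
    fix C :: "'a \<Rightarrow> nat"
    assume C: "C x = 0" "C y = 0" and P: "\<And>v. v \<in> V - {x, y} \<Longrightarrow> if v = a then C v = 1 else if v = b then C v = 2
          else (E v x \<longrightarrow> C v \<noteq> 1) \<and> (E v y \<longrightarrow> C v \<noteq> 2)"
    have Cab: "C a = 1" "C b = 2" using P[OF out(1)] P[OF out(2)] \<open>a \<noteq> b\<close> by auto
    have other: "v = a" if v: "v \<in> V - {x, y}" "E x v" "C v = C a" for v
    proof (rule ccontr)
      assume "v \<noteq> a"
      then have "C v \<noteq> 1" using P[OF v(1)] sym[OF v(2)] by (simp split: if_splits)
      then show False using v(3) Cab by simp
    qed
    have other': "v = b" if v: "v \<in> V - {x, y}" "E y v" "C v = C b" for v
    proof (rule ccontr)
      assume "v \<noteq> b"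
      then have "C v \<noteq> 2" using P[OF v(1)] sym[OF v(2)] by (simp split: if_splits)
      then show False using v(3) Cab by simp
    qed
    have "E x a" "E y b" "\<not> E y x" using ab nadj adj_commute[of y x] by (auto intro: sym)
    then show "happy E V C x \<and> happy E V C y"
      using root_happyI[of x y a C] root_happyI[of y x b C] ab nadj other other' by simp
next
    fix K assume K: "K \<in> cliques"
    note KD = cliqueD[OF K]
    let ?goal = "\<lambda>f. f x = 0 \<and> f y = 0 \<and> (\<forall>v\<in>K. (if v = a then f v = 1 else if v = b then f v = 2
          else (E v x \<longrightarrow> f v \<noteq> 1) \<and> (E v y \<longrightarrow> f v \<noteq> 2)) \<and> f v \<le> (2::nat) \<and> happy E V f v)"
    consider (both) "a \<in> K" "b \<in> K" | (a) "a \<in> K" "b \<notin> K" | (b) "a \<notin> K" "b \<in> K"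
      | (z) "a \<notin> K" "b \<notin> K" "\<exists>z\<in>K. \<not> E z x \<and> \<not> E z y"
      | (none) "a \<notin> K" "b \<notin> K" "\<forall>v\<in>K. E v x \<or> E v y" by blast
    then show "\<exists>f. ?goal f"
    proof cases
      case both
      define f where "f v = (if v = a then 1 else if v = b then 2 else (0::nat))" for v
      have "happy E V f v" if v: "v \<in> K" for v
        by (rule clique_happyI[OF K v, of "if v = a then b else a"])
          (use out \<open>a \<noteq> b\<close> both xy in \<open>auto simp: f_def split: if_splits\<close>)
      then show ?thesis using out \<open>a \<noteq> b\<close> both KD
        by (intro exI[of _ f]) (auto simp: f_def)
    next
      case a
      then have noB: "\<And>v. v \<in> K \<Longrightarrow> \<not> E v y" using same[OF K, of a] ab by blast
      \<comment> \<open>Without neighbours of \<open>y\<close> in \<open>K\<close>, colour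
        \<open>2\<close> is free for the rest, whose witness is \<open>a\<close>; the witness of
        \<open>a\<close> is \<open>x\<close>.\<close>
      define f where "f v = (if v = x \<or> v = y then 0 else if v = a then 1 else (2::nat))" for v
      have "happy E V f v" if v: "v \<in> K" for v
        by (rule clique_happyI[OF K v, of "if v = a then x else a"])
          (use out ab a noB v KD xy in \<open>auto simp: f_def split: if_splits\<close>)
      then show ?thesis using out a KD noB
        by (intro exI[of _ f]) (auto simp: f_def)
    next
      case b
      then have noA: "\<And>v. v \<in> K \<Longrightarrow> \<not> E v x" using same[OF K _ _ _ _ disjI2, of _ b] ab by blast
      define f where "f v = (if v = x \<or> v = y then 0 else if v = b then 2 else (1::nat))" for v
      have "happy E V f v" if v: "v \<in> K" for v
        by (rule clique_happyI[OF K v, of "if v = b then y else b"])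
          (use out ab b noA v KD xy in \<open>auto simp: f_def split: if_splits\<close>)
      then show ?thesis using out b KD noA
        by (intro exI[of _ f]) (auto simp: f_def)
    next
      case z
      then obtain z where zz: "z \<in> K" "\<not> E z x" "\<not> E z y" by blast
      then obtain u where u: "u \<in> K" "u \<noteq> z" using two_in_clique K by blast
      \<comment> \<open>\<open>u\<close> sees at most one root and takes the colour this root
        permits; \<open>z\<close>, seen by no root, takes the other. Then \<open>u\<close> is the
        witness of \<open>z\<close>, and \<open>z\<close> of all others.\<close>
      define f where "f v = (if v = u then (if E u x then 2 else 1) 
          else if v = z then (if E u x then 1 else 2) else (0::nat))" for v
      have "happy E V f v" if v: "v \<in> K" for v
        by (rule clique_happyI[OF K v, of "if v = z then u else z"])
          (use zz u KD xy in \<open>auto simp: f_def split: if_splits\<close>)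
      then show ?thesis using z zz u KD xor[OF u(1) K]
        by (intro exI[of _ f]) (auto simp: f_def)
    next
      case none
      \<comment> \<open>Each vertex sees exactly one root, its only neighbour of colour
        \<open>0\<close>, and takes the colour that this root permits.\<close>
      define f where "f v = (if v = x \<or> v = y then 0 else if E v x then 2 else (1::nat))" for v
      have "happy E V f v" if v: "v \<in> K" for v
        by (rule clique_happyI[OF K v, of "if E v x then x else y"])
          (use none(3) v xor[OF v K] KD xy in \<open>auto simp: f_def split: if_splits\<close>)
      then show ?thesis using none KD xor[OF _ K]
        by (intro exI[of _ f]) (auto simp: f_def)
    qed
  qed auto
qed

lemma colorable: colorable
proof (cases "E x y")
  case True
  then show ?thesis by (rule colorable_adjacent)
next
  case False
  show ?thesis
  proof (cases "\<exists>w\<in>V. E w x \<and> E w y")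
    case True
    then show ?thesis using colorable_nonadjacent_common[OF False] irrefl by blast
  next
    case disj: False
    then show ?thesis using colorable_nonadjacent_disjoint[OF False] by blast
  qed
qed

end

section \<open>Deleting vertices and extending colourings\<close>

context sym_irrefl
begin

text \<open>\<open>k\<close> is the largest colour, so there are \<open>k + 1\<close> of them.
  Isolated vertices are exempt because deletions can create them.\<close>

definition coloring :: "'a set \<Rightarrow> nat \<Rightarrow> ('a \<Rightarrow> nat) \<Rightarrow> bool" where
  "coloring V k C \<longleftrightarrow> C ` V \<subseteq> {..k} \<and> (\<forall>v\<in>V. (\<exists>u\<in>V. E v u) \<longrightarrow> happy E V C v)"

lemma coloring_mono: "coloring V k C \<Longrightarrow> k \<le> l \<Longrightarrow> coloring V l C"
  unfolding coloring_def by auto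

lemma coloring_le: "coloring V k C \<Longrightarrow> v \<in> V \<Longrightarrow> C v \<le> k"
  unfolding coloring_def by auto

lemma coloring_happy: "coloring V k C \<Longrightarrow> v \<in> V \<Longrightarrow> u \<in> V \<Longrightarrow> E v u \<Longrightarrow> happy E V C v"
  unfolding coloring_def by auto

lemma coloring_two:
  assumes fin: "finite V" and X: "X \<subseteq> V" "card X \<le> 2" and clus: "cluster E (V - X)"
  shows "\<exists>C. coloring V 2 C"
proof -
  define W where "W = {v \<in> V. \<exists>u\<in>V. E v u}"
  have WV: "W \<subseteq> V" by (auto simp: W_def)
  have adj_W: "u \<in> W" if "v \<in> V" "u \<in> V" "E v u" for u v
    using that sym[OF that(3)] by (auto simp: W_def)
  have noiso: "\<exists>u\<in>W. E v u" if v: "v \<in> W" for v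
  proof -
    obtain u where "u \<in> V" "E v u" using v unfolding W_def by blast
    then show ?thesis using adj_W[of v u] v WV by blast
  qed
  show ?thesis
  proof (cases "W = {}")
    case True
    then have "coloring V 2 (\<lambda>_. 0)" by (auto simp: coloring_def W_def)
    then show ?thesis by blast
  next
    case False
    then obtain v u where vu: "v \<in> W" "u \<in> W" "E v u" using noiso by blast
    then have "card {v, u} = 2" using irrefl by (metis card_2_iff)
    moreover have "card {v, u} \<le> card W"
      using vu fin WV by (intro card_mono) (auto intro: finite_subset)
    ultimately have cW: "2 \<le> card W" by linarith
    have "card (X \<inter> W) \<le> 2"
      using card_mono[of X "X \<inter> W"] X fin finite_subset by fastforce
    \<comment> \<open>The two-vertex case needs exactly two roots without isolated vertices around,
      so the surviving part of \<open>X\<close> is padded inside \<open>W\<close>.\<close>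
    then obtain Y where Y: "X \<inter> W \<subseteq> Y" "Y \<subseteq> W" "card Y = 2"
      using exists_subset_between[of "X \<inter> W" 2 W] cW fin WV finite_subset by blast
    then obtain x y where xy: "Y = {x, y}" "x \<noteq> y" by (meson card_2_iff)
    interpret two_vertex_cluster E W x y
      by unfold_locales
        (use xy Y noiso WV in \<open>auto intro: cluster_subset[OF clus]\<close>)
    obtain C where C: "\<forall>v\<in>W. happy E W C v" "C ` W \<subseteq> {..2}"
      using colorable unfolding colorable_def by blast
    define D where "D v = (if v \<in> W then C v else 0)" for v
    have "happy E V D v" if "v \<in> V" "u \<in> V" "E v u" for v u
    proof -
      have "v \<in> W" using that by (auto simp: W_def)
      then have "happy E W C v" using C by blast
      then show ?thesis
        unfolding happy_def D_def using adj_W[OF that(1)] WV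
        by (smt (verit, best) subsetD)
    qed
    then have "coloring V 2 D"
      using C by (auto simp: coloring_def D_def)
    then show ?thesis by blast
  qed
qed

lemma coloring_delete_edge:
  assumes yw: "y \<in> V" "w \<in> V" "E y w"
    and no: "\<not> (\<exists>v\<in>V. {u\<in>V. E v u} = {y, w})"
    and C: "coloring (V - {y, w}) k C"
  shows "coloring V (Suc k) (C(y := Suc k, w := Suc k))"
proof -
  define D where "D = C(y := Suc k, w := Suc k)"
  have lt: "v \<in> V \<Longrightarrow> v \<noteq> y \<Longrightarrow> v \<noteq> w \<Longrightarrow> C v < Suc k" for v
    using coloring_le[OF C, of v] by auto
  then have range: "D ` V \<subseteq> {..Suc k}" by (auto simp: D_def less_imp_le)
  have new: "D u = Suc k \<longleftrightarrow> u = y \<or> u = w" if "u \<in> V" for u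
    using lt[OF that] by (auto simp: D_def)
  have "happy E V D v" if v: "v \<in> V" "\<exists>u\<in>V. E v u" for v
  proof -
    consider "E v y" "\<not> E v w" | "E v w" "\<not> E v y" | "E v y \<longleftrightarrow> E v w" by blast
    then show "happy E V D v"
    proof cases
      case 1
      show ?thesis
      proof (rule happyI[of y])
        fix u assume u: "u \<in> V" "E v u" "D u = D y"
        then have "u = y \<or> u = w" using new[of u] new[OF yw(1)] new[OF yw(2)] by simp
        then show "u = y" using 1 u by blast
      qed (use 1 yw in auto)
    next
      case 2
      show ?thesis
      proof (rule happyI[of w])
        fix u assume u: "u \<in> V" "E v u" "D u = D w"
        then have "u = y \<or> u = w" using new[of u] new[OF yw(1)] new[OF yw(2)] by simp
        then show "u = w" using 2 u by blast
      qed (use 2 yw in auto)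
    next
      case 3
      then have vyw: "v \<noteq> y" "v \<noteq> w" using yw irrefl sym by blast+
      \<comment> \<open>If \<open>v\<close> sees both deleted vertices, \<open>no\<close> gives a
        third neighbour; if it sees neither, any neighbour will do. The old witness then has a
        colour below the new one.\<close>
      have "\<exists>u\<in>V - {y, w}. E v u"
        using no v 3 yw by blast
      then have "happy E (V - {y, w}) C v"
        using coloring_happy[OF C, of v] v vyw by blast
      then obtain u where u: "u \<in> V - {y, w}" "E v u"
        and uniq: "\<And>u'. u' \<in> V - {y, w} \<Longrightarrow> E v u' \<Longrightarrow> C u' = C u \<Longrightarrow> u' = u"
        unfolding happy_def by blast
      show ?thesis
        by (rule happyI[of u]) (use u uniq lt in \<open>auto simp: D_def split: if_splits\<close>)
    qed
  qed
  with range show ?thesis by (auto simp: coloring_def D_def)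
qed

text \<open>\<open>y\<close> is the witness of all its neighbours by the new colour, and
  \<open>v0\<close> is the witness of \<open>y\<close> by colour \<open>0\<close>. The bound
  \<open>1 \<le> k\<close> separates \<open>Suc k\<close> from the colours \<open>0\<close> and
  \<open>1\<close> on the triangles.\<close>

lemma coloring_delete_friendship:
  assumes y: "y \<in> V" "v0 \<in> V" "E y v0"
    and fr: "\<And>v. v \<in> V \<Longrightarrow> E y v \<Longrightarrow> \<exists>v'\<in>V. {u\<in>V. E v u} = {y, v'} \<and> E y v'"
    and C: "coloring (V - insert y {v. E y v}) k C" and k: "1 \<le> k"
  shows "\<exists>D. coloring V (Suc k) D"
proof -
  define D where "D v = (if v = y then Suc k else if v = v0 then 0 else if E y v then 1 else C v)" for v
  have "happy E V D v" if v: "v \<in> V" "u \<in> V" "E v u" for v u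
  proof -
    consider "v = y" | "E y v" | "v \<in> V - insert y {v. E y v}" using v by blast
    then show ?thesis
    proof cases
      case 1
      show ?thesis by (rule happyI[of v0]) (use 1 y irrefl in \<open>auto simp: D_def split: if_splits\<close>)
    next
      case 2
      then obtain v' where v': "{u\<in>V. E v u} = {y, v'}" "E y v'" using fr v by blast
      have "u = y \<or> u = v'" if "u \<in> V" "E v u" for u using that v' by blast
      then show ?thesis
        by (intro happyI[of y]) (use 2 y v' k adj_commute[of y v] in \<open>auto simp: D_def split: if_splits\<close>)
    next
      case 3
      \<comment> \<open>A neighbour of \<open>y\<close> sees only \<open>y\<close> and another
        neighbour of \<open>y\<close>, so no edge leaves the deleted set.\<close>
      have far: "u \<in> V - insert y {v. E y v}" if u: "u \<in> V" "E v u" for u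
      proof -
        have "\<not> E y u"
        proof
          assume "E y u"
          then obtain v' where "{w\<in>V. E u w} = {y, v'}" "E y v'" using fr u by blast
          then show False using sym[OF u(2)] v(1) 3 by blast
        qed
        then show ?thesis using u 3 sym by blast
      qed
      have "happy E (V - insert y {v. E y v}) C v"
        using coloring_happy[OF C 3 far] v by blast
      then obtain u where u: "u \<in> V - insert y {v. E y v}" "E v u"
        and uniq: "\<And>u'. u' \<in> V - insert y {v. E y v} \<Longrightarrow> E v u' \<Longrightarrow> C u' = C u \<Longrightarrow> u' = u"
        unfolding happy_def by blast
      have DC: "D u' = C u'" if "u' \<in> V" "E v u'" for u'
        using far[OF that] y by (auto simp: D_def)
      show ?thesis
        by (rule happyI[of u]) (use u uniq far DC in auto)
    qed
  qed
  moreover have "D v \<le> Suc k" if "v \<in> V" for v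
    using coloring_le[OF C, of v] that by (auto simp: D_def)
  ultimately have "coloring V (Suc k) D" by (auto simp: coloring_def)
  then show ?thesis by blast
qed

text \<open>The offset makes \<open>n = 0\<close> the case of at most two deleted vertices and the
  three colours \<open>0\<close>, \<open>1\<close>, \<open>2\<close>. \<open>V\<close> varies in the
  induction because vertices outside \<open>X\<close> are deleted as well.\<close>

lemma ex_coloring:
  assumes "finite V" "X \<subseteq> V" "cluster E (V - X)" "card X \<le> n + 2"
  shows "\<exists>C. coloring V (n + 2) C"
  using assms
proof (induction n arbitrary: V X)
  case 0
  then show ?case using coloring_two by (metis add_0)
next
  case (Suc n)
  have fX: "finite X" using Suc.prems finite_subset by blast
  have IH: "\<exists>C. coloring (V - S) (n + 2) C" if "y \<in> X" "y \<in> S" for S y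
  proof (rule Suc.IH[of _ "X - S"])
    have "card (X - S) \<le> card (X - {y})" using that fX by (intro card_mono) auto
    then show "card (X - S) \<le> n + 2" using that fX Suc.prems by simp
    show "cluster E (V - S - (X - S))"
      by (rule cluster_subset[OF Suc.prems(3)]) blast
  qed (use Suc.prems in auto)
  show ?case
  proof (cases "X = {}")
    case True
    then have "\<exists>C. coloring V (n + 2) C" using Suc.IH[of V X] Suc.prems by simp
    moreover have "n + 2 \<le> Suc n + 2" by simp
    ultimately show ?thesis using coloring_mono by blast
  next
    case False
    then obtain y where y: "y \<in> X" "y \<in> V" using Suc.prems by blast
    have del_edge: "\<exists>C. coloring V (Suc n + 2) C"
      if w: "w \<in> V" "E y w" "\<not> (\<exists>v\<in>V. {u\<in>V. E v u} = {y, w})" for w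
    proof -
      obtain C where "coloring (V - {y, w}) (n + 2) C" using IH y by blast
      then show ?thesis using coloring_delete_edge[of y V w] y w by auto
    qed
    consider (isolated) "\<forall>w\<in>V. \<not> E y w"
      | (edge) w where "w \<in> V" "E y w" "\<not> (\<exists>v\<in>V. {u\<in>V. E v u} = {y, w})"
      | (friendship) w where "w \<in> V" "E y w"
        "\<And>w. w \<in> V \<Longrightarrow> E y w \<Longrightarrow> \<exists>v\<in>V. {u\<in>V. E v u} = {y, w}" by metis
    then show ?thesis
    proof cases
      case isolated
      obtain C where C: "coloring (V - {y}) (n + 2) C" using IH y by blast
      have "happy E V (C(y := 0)) v" if v: "v \<in> V" "u \<in> V" "E v u" for u v
      proof -
        have "v \<noteq> y" "u \<noteq> y" using v isolated sym by blast+
        then have "happy E (V - {y}) C v" using coloring_happy[OF C, of v u] v by blast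
        then show ?thesis unfolding happy_def using isolated sym v
          by (metis (no_types, lifting) Diff_iff fun_upd_other singletonD)
      qed
      then have "coloring V (Suc n + 2) (C(y := 0))"
        using coloring_le[OF C] unfolding coloring_def by fastforce
      then show ?thesis by blast
    next
      case (edge w)
      then show ?thesis using del_edge by blast
    next
      case (friendship w)
      have fr: "\<exists>v'\<in>V. {u\<in>V. E v u} = {y, v'} \<and> E y v'" if v: "v \<in> V" "E y v" for v
      proof -
        \<comment> \<open>The assumption is applied twice: \<open>u\<close>, obtained from
          \<open>v'\<close>, is adjacent to \<open>v'\<close> and differs from \<open>y\<close>, and
          the neighbours of \<open>v'\<close> are \<open>y\<close> and \<open>v\<close>, so
          \<open>u = v\<close>.\<close>
        obtain v' where v': "v' \<in> V" "{u\<in>V. E v' u} = {y, v}" using friendship(3) v by blast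
        then have "E y v'" using sym y by blast
        then obtain u where u: "u \<in> V" "{a\<in>V. E u a} = {y, v'}" using friendship(3) v' by blast
        then have "E v' u" using sym v' by blast
        then have "u = v" using v' u irrefl \<open>E y v'\<close> y by blast
        then show ?thesis using u v' \<open>E y v'\<close> by blast
      qed
      obtain C where "coloring (V - insert y {v. E y v}) (n + 2) C" using IH y by blast
      from coloring_delete_friendship[OF y(2) friendship(1,2) fr this]
      show ?thesis by (simp only: add_Suc)
    qed
  qed
qed

end

section \<open>Transfer to the graph and its parameters\<close>

theorem theorem1:
  fixes G :: "('a,'b) pre_digraph"
  assumes "graph G"
    and "Digraph_Component.connected G"
    and "card (verts G) \<ge> 2"
  shows "cfon_chromatic_number G \<le> max 3 (enat (distance_to_cluster G) + 1)"
proof -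
  interpret graph G by fact
  let ?E = "\<lambda>u v. u \<rightarrow>\<^bsub>G\<^esub> v" and ?V = "verts G" and ?d = "distance_to_cluster G"
  interpret sym_irrefl ?E
  proof
    show "v \<rightarrow>\<^bsub>G\<^esub> u" if "u \<rightarrow>\<^bsub>G\<^esub> v" for u v
      using arcs_ends_symmetric[OF sym_arcs that] .
    show "\<not> v \<rightarrow>\<^bsub>G\<^esub> v" for v
      using adj_not_same by blast
  qed
  \<comment> \<open>Deleting every vertex leaves a cluster, so the \<open>LEAST\<close> is
    attained.\<close>
  have "disjoint_union_of_cliques (G \<restriction> (?V - ?V))"
    unfolding disjoint_union_of_cliques_def by (auto intro: exI[of _ "{}"] simp: partition_on_def)
  then have "\<exists>d X. X \<subseteq> ?V \<and> finite X \<and> card X = d \<and> disjoint_union_of_cliques (G \<restriction> (?V - X))"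
    using finite_verts by blast
  from LeastI_ex[OF this] obtain X where X: "X \<subseteq> ?V" "card X = ?d"
    and duc: "disjoint_union_of_cliques (G \<restriction> (?V - X))"
    unfolding distance_to_cluster_def by blast
  have ind: "u \<rightarrow>\<^bsub>G \<restriction> S\<^esub> v \<longleftrightarrow> u \<rightarrow>\<^bsub>G\<^esub> v" if "u \<in> S" "v \<in> S" for u v S
    using that by (auto simp: arcs_ends_conv)
  have "cluster ?E (?V - X)"
  proof -
    obtain P where P: "partition_on (?V - X) P"
      and adj: "\<And>u v. u \<in> ?V - X \<Longrightarrow> v \<in> ?V - X \<Longrightarrow>
        u \<rightarrow>\<^bsub>G\<^esub> v \<longleftrightarrow> u \<noteq> v \<and> (\<exists>K\<in>P. u \<in> K \<and> v \<in> K)"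
      using duc ind unfolding disjoint_union_of_cliques_def by auto
    have "K = K'" if "K \<in> P" "K' \<in> P" "v \<in> K" "v \<in> K'" for K K' v
      using P that by (auto simp: partition_on_def disjoint_def)
    then show ?thesis unfolding cluster_def using adj by metis
  qed
  then have "\<exists>C. coloring ?V ((?d - 2) + 2) C"
    by (rule ex_coloring[OF finite_verts X(1)]) (use X(2) in linarith)
  then obtain C where C: "coloring ?V ((?d - 2) + 2) C" by blast
  define k where "k = max 3 (?d + 1)"
  \<comment> \<open>Truncated subtraction produces the maximum: for \<open>?d \<le> 2\<close> the
    largest colour is \<open>2\<close>. \<open>Suc\<close> accounts for colour
    \<open>0\<close>.\<close>
  have k: "k = Suc ((?d - 2) + 2)" by (auto simp: k_def)
  \<comment> \<open>A walk from \<open>v\<close> to a second vertex starts with an edge, so the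
    exemption for isolated vertices is void here.\<close>
  have noiso: "\<exists>u\<in>?V. ?E v u" if v: "v \<in> ?V" for v
  proof -
    have "?V \<noteq> {v}" using assms(3) by auto
    then obtain u where u: "u \<in> ?V" "u \<noteq> v" using v by blast
    have "v \<rightarrow>\<^sup>*\<^bsub>G\<^esub> u"
      using symmetric_connected_imp_strongly_connected[OF sym_arcs assms(2)] u v
      unfolding strongly_connected_def by blast
    then obtain w where "v \<rightarrow>\<^bsub>G\<^esub> w"
      by (rule converse_reachable_cases) (use u(2) in blast)+
    then show ?thesis using adj_in_verts(2) by blast
  qed
  have "cfon_coloring G k (Suc \<circ> C)"
    unfolding cfon_coloring_def
  proof (intro conjI ballI)
    show range: "(Suc \<circ> C) ` ?V \<subseteq> {1..k}" using coloring_le[OF C] by (auto simp: k)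
    fix v assume v: "v \<in> ?V"
    then have "happy ?E ?V C v" using coloring_happy[OF C] noiso by blast
    then obtain u where u: "u \<in> ?V" "?E v u"
      and uniq: "\<And>u'. u' \<in> ?V \<Longrightarrow> ?E v u' \<Longrightarrow> C u' = C u \<Longrightarrow> u' = u"
      unfolding happy_def by blast
    then have "{u' \<in> open_neighborhood G v. (Suc \<circ> C) u' = Suc (C u)} = {u}"
      unfolding open_neighborhood_def comp_apply by blast
    then have "card {u' \<in> open_neighborhood G v. (Suc \<circ> C) u' = Suc (C u)} = 1" by simp
    then show "\<exists>i\<in>{1..k}. card {u \<in> open_neighborhood G v. (Suc \<circ> C) u = i} = 1"
      using range u(1) by (intro bexI[of _ "Suc (C u)"]) (simp_all add: image_subset_iff)
  qed
  then have "cfon_chromatic_number G \<le> enat k"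
    unfolding cfon_chromatic_number_def by (intro Inf_lower) blast
  also have "enat k = max 3 (enat ?d + 1)"
    by (simp add: k_def one_enat_def numeral_eq_enat)
  finally show ?thesis .
qed

end
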